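(* Let $N\ge 2$ and $m\ge 1$ be integers and let $x^{(r,s)}_k$ ($1\le r,s\le N$, $1\le k\le m$) be elements of a commutative ring; set $x^{(r,s)}_{m+1}=0$ for all $1\le r,s\le N$. Let $C(N,m)$ be the $Nm\times Nm$ matrix which, as an $N\times N$ block matrix with $m\times m$ blocks, has $(r,s)$ block $C_m(x^{(r,s)}_1,\dots,x^{(r,s)}_m)$. Then $$\det(C(N,m))=\begin{cases}(-1)^{\frac{Nm}{2}}\prod_{i=1}^{m}\det(X_{(i,i+1)}), & \text{if } m \text{ is even},\\[2pt] (-1)^{\frac{N(m-1)}{2}}\prod_{i=1}^{m}\det(X_{(i,i+1)}), & \text{if } m \text{ is odd}.\end{cases}$$
   Context: For elements $x_1,\dots,x_m$, $C_m(x_1,\dots,x_m)$ is the $m\times m$ matrix whose $(p,q)$ entry is $x_{\max(p,\,m+1-q)}$ (top-right entry $x_1$, first column and last row constantly $x_m$). For $1\le i\le m$, $X_{(i,i+1)}$ is the $N\times N$ matrix whose $(r,s)$ entry is $x^{(r,s)}_i-x^{(r,s)}_{i+1}$. *)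

theory Defs
  imports "Jordan_Normal_Form.Determinant"
begin

text \<open>
  Matrices of \<open>Jordan_Normal_Form\<close> are indexed from 0. The families of ring elements below
  are indexed from 1, so position \<open>(i, j)\<close> of a matrix is row \<open>Suc i\<close> and
  column \<open>Suc j\<close> in 1-based numbering.
\<close>

definition C_mat :: "nat \<Rightarrow> (nat \<Rightarrow> 'a) \<Rightarrow> 'a mat" where
  "C_mat m x = mat m m (\<lambda>(i, j). let p = Suc i; q = Suc j in x (max p (m + 1 - q)))"

text \<open>
  In the next two definitions \<open>x r s k\<close> stands for the element with superscript
  \<open>(r, s)\<close> and subscript \<open>k\<close>. Row \<open>i\<close> of the large matrix is row
  \<open>i mod m\<close> of block row \<open>i div m\<close>, and likewise for columns.
\<close>

definition C_block_mat :: "nat \<Rightarrow> nat \<Rightarrow> (nat \<Rightarrow> nat \<Rightarrow> nat \<Rightarrow> 'a) \<Rightarrow> 'a mat" where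
  "C_block_mat N m x = mat (N * m) (N * m) (\<lambda>(i, j).
     C_mat m (x (Suc (i div m)) (Suc (j div m))) $$ (i mod m, j mod m))"

definition X_diff :: "nat \<Rightarrow> (nat \<Rightarrow> nat \<Rightarrow> nat \<Rightarrow> 'a :: minus) \<Rightarrow> nat \<Rightarrow> 'a mat" where
  "X_diff N x i = mat N N (\<lambda>(a, b). let r = Suc a; s = Suc b in x r s i - x r s (i + 1))"

end

theory Submission
  imports Defs
begin

text \<open>
  Put \<open>y\<^sub>l = x\<^sub>l - x\<^sub>l\<^sub>+\<^sub>1\<close>. Since \<open>x\<^sub>m\<^sub>+\<^sub>1 = 0\<close>, the entry \<open>x\<^sub>k\<close> is the sum of the
  \<open>y\<^sub>l\<close> with \<open>l \<ge> k\<close>, so every block factors as \<open>U * diag(y\<^sub>1, \<dots>, y\<^sub>m) * V\<close> with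
  \<open>U\<close> unitriangular and \<open>V\<close> an anti-triangular 0-1 matrix, both independent of the block.
  The large matrix is therefore a product of a block diagonal matrix with blocks \<open>U\<close>, a matrix
  whose blocks are diagonal, and a block diagonal matrix with blocks \<open>V\<close>. Swapping the two
  levels of indexing turns the middle factor into the block diagonal matrix with blocks
  \<open>X_diff N x i\<close>, and the sign comes from \<open>det V\<close>.
\<close>

section \<open>Determinants of block diagonal matrices\<close>

text \<open>The identity block is peeled off one row and column at a time; each time the last column
  is zero except for its corner entry 1. This handles one factor of diag(A, D) = diag(A, 1) *
  diag(1, D).\<close>

lemma det_four_block_one_lower:
  fixes A :: "'a :: comm_ring_1 mat"
  assumes A: "A \<in> carrier_mat n n"
  shows "det (four_block_mat A (0\<^sub>m n k) (0\<^sub>m k n) (1\<^sub>m k)) = det A"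
proof (induction k)
  case 0
  have "four_block_mat A (0\<^sub>m n 0) (0\<^sub>m 0 n) (1\<^sub>m 0) = A"
    using A by (intro eq_matI) auto
  then show ?case by simp
next
  case (Suc k)
  let ?B = "four_block_mat A (0\<^sub>m n k) (0\<^sub>m k n) (1\<^sub>m k)"
  have B: "?B \<in> carrier_mat (n + k) (n + k)" using A by simp
  have "four_block_mat A (0\<^sub>m n (Suc k)) (0\<^sub>m (Suc k) n) (1\<^sub>m (Suc k)) =
      four_block_mat ?B (0\<^sub>m (n + k) 1) (0\<^sub>m 1 (n + k)) (1\<^sub>m 1)"
    using A by (intro eq_matI) (auto split: if_splits)
  then show ?case
    using Suc.IH det_four_block_mat_upper_right_zero_col[OF B refl, of "0\<^sub>m 1 (n + k)" "1\<^sub>m 1"]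
    by simp
qed

lemma det_four_block_one_upper:
  fixes D :: "'a :: comm_ring_1 mat"
  assumes D: "D \<in> carrier_mat n n"
  shows "det (four_block_mat (1\<^sub>m k) (0\<^sub>m k n) (0\<^sub>m n k) D) = det D"
proof (induction k)
  case 0
  have "four_block_mat (1\<^sub>m 0) (0\<^sub>m 0 n) (0\<^sub>m n 0) D = D"
    using D by (intro eq_matI) auto
  then show ?case by simp
next
  case (Suc k)
  let ?B = "four_block_mat (1\<^sub>m k) (0\<^sub>m k n) (0\<^sub>m n k) D"
  have B: "?B \<in> carrier_mat (k + n) (k + n)" using D by simp
  have "four_block_mat (1\<^sub>m (Suc k)) (0\<^sub>m (Suc k) n) (0\<^sub>m n (Suc k)) D =
      four_block_mat (1\<^sub>m 1) (0\<^sub>m 1 (k + n)) (0\<^sub>m (k + n) 1) ?B"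
    using D by (intro eq_matI) (auto split: if_splits)
  then show ?case
    using Suc.IH det_four_block_mat_lower_left_zero_col[of "1\<^sub>m 1" "0\<^sub>m 1 (k + n)", OF _ _ refl B]
    by simp
qed

text \<open>
  The library proves this for block triangular matrices, but only over integral domains.
\<close>

lemma det_four_block_diag:
  fixes A D :: "'a :: comm_ring_1 mat"
  assumes A: "A \<in> carrier_mat n n" and D: "D \<in> carrier_mat k k"
  shows "det (four_block_mat A (0\<^sub>m n k) (0\<^sub>m k n) D) = det A * det D"
proof -
  let ?A = "four_block_mat A (0\<^sub>m n k) (0\<^sub>m k n) (1\<^sub>m k)"
  let ?D = "four_block_mat (1\<^sub>m n) (0\<^sub>m n k) (0\<^sub>m k n) D"
  have "four_block_mat A (0\<^sub>m n k) (0\<^sub>m k n) D = ?A * ?D"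
    using A D by (subst mult_four_block_mat[of _ n n _ k _ k _ _ n _ k]) auto
  also have "det \<dots> = det ?A * det ?D"
    using A D by (intro det_mult[where n = "n + k"]) auto
  finally show ?thesis
    by (simp add: det_four_block_one_lower[OF A] det_four_block_one_upper[OF D])
qed

definition block_diag :: "nat \<Rightarrow> nat \<Rightarrow> (nat \<Rightarrow> 'a :: zero mat) \<Rightarrow> 'a mat" where
  "block_diag N m A = mat (N * m) (N * m)
     (\<lambda>(i, j). if i div m = j div m then A (i div m) $$ (i mod m, j mod m) else 0)"

lemma block_diag_carrier [simp]: "block_diag N m A \<in> carrier_mat (N * m) (N * m)"
  by (simp add: block_diag_def)

text \<open>Splitting off the last block leaves a two-block diagonal matrix, so induction on
  \<open>N\<close> applies.\<close>

lemma det_block_diag: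
  fixes A :: "nat \<Rightarrow> 'a :: comm_ring_1 mat"
  assumes "\<And>r. A r \<in> carrier_mat m m"
  shows "det (block_diag N m A) = (\<Prod>r<N. det (A r))"
proof (induction N)
  case 0
  then show ?case by (simp add: block_diag_def)
next
  case (Suc N)
  have last: "i div m = N" "i mod m = i - N * m" if i: "i < m + N * m" "\<not> i < N * m" for i
  proof -
    obtain l where "i = N * m + l" "l < m"
      using i by (auto simp: not_less dest!: le_Suc_ex)
    then show "i div m = N" "i mod m = i - N * m" by simp_all
  qed
  have first: "i div m < N" if "i < N * m" for i
    using that by (simp add: less_mult_imp_div_less)
  have "block_diag (Suc N) m A =
      four_block_mat (block_diag N m A) (0\<^sub>m (N * m) m) (0\<^sub>m m (N * m)) (A N)"
    (is "_ = ?F")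
  proof (rule eq_matI)
    fix i j assume "i < dim_row ?F" "j < dim_col ?F"
    then have ij: "i < m + N * m" "j < m + N * m"
      using assms[of N] by (simp_all add: block_diag_def)
    show "block_diag (Suc N) m A $$ (i, j) = ?F $$ (i, j)"
      using assms[of N] ij last[of i] last[of j] first[of i] first[of j]
      by (cases "i < N * m"; cases "j < N * m") (simp_all add: block_diag_def)
  qed (use assms[of N] in \<open>simp_all add: block_diag_def\<close>)
  then show ?case
    using Suc.IH det_four_block_diag[OF block_diag_carrier assms] by simp
qed

section \<open>Interchanging block number and offset\<close>

text \<open>Rows and columns each contribute \<open>signof p\<close>, and its square is 1. Hence the
  sign of the index swap never has to be computed.\<close>

lemma det_permute_simultaneous:
  fixes A :: "'a :: comm_ring_1 mat"
  assumes A: "A \<in> carrier_mat n n" and p: "p permutes {0..<n}"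
  shows "det (mat n n (\<lambda>(i, j). A $$ (p i, p j))) = det A"
proof -
  have lt: "p i < n" if "i < n" for i
    using permutes_in_image[OF p, of i] that by simp
  define B where "B = mat n n (\<lambda>(i, j). A $$ (p i, j))"
  have B: "B \<in> carrier_mat n n" by (simp add: B_def)
  \<comment> \<open>Permuting columns is permuting rows of the transpose.\<close>
  have "mat n n (\<lambda>(i, j). A $$ (p i, p j)) = (mat n n (\<lambda>(i, j). B\<^sup>T $$ (p i, j)))\<^sup>T"
    by (intro eq_matI) (auto simp: B_def lt)
  also have "det \<dots> = signof p * det (B\<^sup>T)"
    using B by (subst det_transpose[where n = n]) (auto intro!: det_permute_rows p)
  also have "det (B\<^sup>T) = signof p * det A"
    unfolding det_transpose[OF B] unfolding B_def by (rule det_permute_rows[OF A p])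
  finally show ?thesis
    by (simp add: sign_def)
qed

text \<open>With \<open>k = l * N + r\<close>, the digits \<open>(l, r)\<close> go to
  \<open>r * m + l\<close>: this transposes an \<open>m\<close> by \<open>N\<close> array stored row
  by row. Points outside the range are fixed, as \<open>permutes\<close> demands.\<close>

lemma div_mod_swap_permutes:
  fixes N m :: nat
  defines "p \<equiv> \<lambda>k. if k < m * N then (k mod N) * m + k div N else k"
  shows "p permutes {0..<m * N}"
proof (rule bij_imp_permutes)
  have lt: "(k mod N) * m + k div N < m * N" if "k < m * N" for k
  proof -
    have "k div N < m" using that by (simp add: less_mult_imp_div_less)
    moreover have "Suc (k mod N) * m \<le> N * m"
      using that by (intro mult_le_mono1) (cases N, simp_all add: Suc_le_eq)
    ultimately show ?thesis by (simp add: mult.commute)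
  qed
  have inj: "inj_on p {0..<m * N}"
  proof (rule inj_onI)
    fix k l assume k: "k \<in> {0..<m * N}" and l: "l \<in> {0..<m * N}" and eq: "p k = p l"
    have "k div N < m" "l div N < m"
      using k l by (auto simp: less_mult_imp_div_less)
    \<comment> \<open>Both digits of \<open>k\<close> can be read back from \<open>p k\<close>,
      hence injectivity; finiteness then gives bijectivity.\<close>
    then have digits: "(k mod N * m + k div N) div m = k mod N" "(l mod N * m + l div N) div m = l mod N"
        "(k mod N * m + k div N) mod m = k div N" "(l mod N * m + l div N) mod m = l div N"
      by simp_all
    have "k mod N * m + k div N = l mod N * m + l div N"
      using eq k l by (simp add: p_def)
    then have "k mod N = l mod N" "k div N = l div N"
      using digits by simp_all
    then show "k = l" by (metis div_mult_mod_eq)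
  qed
  have "p ` {0..<m * N} \<subseteq> {0..<m * N}"
    using lt by (auto simp: p_def)
  then show "bij_betw p {0..<m * N} {0..<m * N}"
    using inj by (simp add: bij_betw_def endo_inj_surj)
  show "p k = k" if "k \<notin> {0..<m * N}" for k
    using that by (simp add: p_def)
qed

text \<open>An \<open>N\<close> by \<open>N\<close> array of diagonal blocks of size
  \<open>m\<close>; \<open>A l\<close> collects the entries at diagonal position \<open>l\<close> of
  all blocks. It is \<open>block_diag\<close> with the roles of \<open>div\<close> and
  \<open>mod\<close> exchanged.\<close>

definition diag_blocks :: "nat \<Rightarrow> nat \<Rightarrow> (nat \<Rightarrow> 'a :: zero mat) \<Rightarrow> 'a mat" where
  "diag_blocks N m A = mat (N * m) (N * m)
     (\<lambda>(i, j). if i mod m = j mod m then A (i mod m) $$ (i div m, j div m) else 0)"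

lemma diag_blocks_carrier [simp]: "diag_blocks N m A \<in> carrier_mat (N * m) (N * m)"
  by (simp add: diag_blocks_def)

text \<open>Reindexing rows and columns by the same swap turns offsets into block numbers, which
  leaves \<open>m\<close> diagonal blocks of size \<open>N\<close>.\<close>

lemma det_diag_blocks:
  fixes A :: "nat \<Rightarrow> 'a :: comm_ring_1 mat"
  assumes A: "\<And>l. A l \<in> carrier_mat N N"
  shows "det (diag_blocks N m A) = (\<Prod>l<m. det (A l))"
proof -
  define p where "p = (\<lambda>k. if k < m * N then (k mod N) * m + k div N else k)"
  have p: "p permutes {0..<m * N}"
    unfolding p_def by (rule div_mod_swap_permutes)
  have lt: "p k < m * N" if "k < m * N" for k
    using permutes_in_image[OF p, of k] that by simp
  have pdiv: "p k div m = k mod N" and pmod: "p k mod m = k div N" if "k < m * N" for k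
  proof -
    have "k div N < m" using that by (simp add: less_mult_imp_div_less)
    then show "p k div m = k mod N" "p k mod m = k div N"
      using that by (auto simp: p_def)
  qed
  have "block_diag m N A =
      mat (m * N) (m * N) (\<lambda>(i, j). diag_blocks N m A $$ (p i, p j))"
    by (intro eq_matI)
      (auto simp: block_diag_def diag_blocks_def pdiv pmod lt mult.commute[of N m])
  moreover have "diag_blocks N m A \<in> carrier_mat (m * N) (m * N)"
    by (simp add: mult.commute[of m N])
  ultimately have "det (block_diag m N A) = det (diag_blocks N m A)"
    using det_permute_simultaneous p by metis
  then show ?thesis by (simp add: det_block_diag A)
qed

section \<open>The two constant factors\<close>

text \<open>As a left factor it forms tail sums: row \<open>a\<close> adds up all positions
  \<open>l\<close> with \<open>a \<le> l\<close>.\<close>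

definition upper_ones :: "nat \<Rightarrow> 'a :: comm_ring_1 mat" where
  "upper_ones m = mat m m (\<lambda>(i, j). if i \<le> j then 1 else 0)"

text \<open>Ones on and below the antidiagonal: in 1-based indices the condition is p + q \<ge> m +
  1. Column \<open>b\<close> selects the positions from \<open>m - Suc b\<close> on.\<close>

definition anti_ones :: "nat \<Rightarrow> 'a :: comm_ring_1 mat" where
  "anti_ones m = mat m m (\<lambda>(i, j). if m \<le> Suc (i + j) then 1 else 0)"

lemma upper_ones_carrier [simp]: "upper_ones m \<in> carrier_mat m m"
  by (simp add: upper_ones_def)

lemma anti_ones_carrier [simp]: "anti_ones m \<in> carrier_mat m m"
  by (simp add: anti_ones_def)

lemma det_upper_ones: "det (upper_ones m :: 'a :: comm_ring_1 mat) = 1"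
proof -
  have "det (upper_ones m :: 'a mat) = prod_list (diag_mat (upper_ones m))"
    by (rule det_upper_triangular[OF _ upper_ones_carrier])
      (auto simp: upper_triangular_def upper_ones_def)
  then show ?thesis by (simp add: prod_list_diag_prod upper_ones_def)
qed

text \<open>The first column has a single 1, in the bottom row; deleting that row and column leaves
  the next smaller matrix of the same shape, with cofactor sign \<open>(- 1) ^ m\<close>.\<close>

lemma det_anti_ones: "det (anti_ones m :: 'a :: comm_ring_1 mat) = (- 1) ^ (\<Sum>i<m. i)"
proof (induction m)
  case 0
  then show ?case by (simp add: anti_ones_def)
next
  case (Suc m)
  let ?V = "anti_ones (Suc m) :: 'a mat"
  have "mat_delete ?V m 0 = anti_ones m"
    by (intro eq_matI) (auto simp: mat_delete_def anti_ones_def)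
  then have minor: "cofactor ?V m 0 = (- 1) ^ m * det (anti_ones m :: 'a mat)"
    by (simp add: cofactor_def)
  have "det ?V = (\<Sum>i<Suc m. ?V $$ (i, 0) * cofactor ?V i 0)"
    by (rule laplace_expansion_column) auto
  also have "\<dots> = cofactor ?V m 0"
    by (simp add: anti_ones_def)
  finally show ?case
    by (simp add: minor Suc.IH power_add mult.commute)
qed

section \<open>Factorization of the block matrix\<close>

text \<open>The indices with quotient \<open>r\<close> are exactly \<open>r * m + l\<close> with
  \<open>l < m\<close>. This collapses products with a block diagonal factor to sums over one
  block.\<close>

lemma sum_div_eq:
  fixes f :: "nat \<Rightarrow> 'a :: comm_monoid_add"
  assumes "r < N"
  shows "(\<Sum>k<N * m. if k div m = r then f k else 0) = (\<Sum>l<m. f (r * m + l))"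
proof -
  have eq: "{k. k < N * m \<and> k div m = r} = (\<lambda>l. r * m + l) ` {..<m}"
  proof (intro equalityI subsetI)
    fix k assume "k \<in> {k. k < N * m \<and> k div m = r}"
    then have "k = r * m + k mod m" "k mod m < m"
      by (auto intro!: mod_less_divisor gr0I)
    then show "k \<in> (\<lambda>l. r * m + l) ` {..<m}" by blast
  next
    fix k assume "k \<in> (\<lambda>l. r * m + l) ` {..<m}"
    then obtain l where l: "k = r * m + l" "l < m" by auto
    moreover have "Suc r * m \<le> N * m" using assms by (intro mult_le_mono1) simp
    ultimately show "k \<in> {k. k < N * m \<and> k div m = r}" by simp
  qed
  have "(\<Sum>k<N * m. if k div m = r then f k else 0) = sum f {k. k < N * m \<and> k div m = r}"
    by (simp add: sum.inter_filter[symmetric])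
  also have "\<dots> = (\<Sum>l<m. f (r * m + l))"
    unfolding eq by (subst sum.reindex) (auto simp: inj_on_def)
  finally show ?thesis .
qed

lemma mult_block_diag_index:
  fixes A :: "'a :: comm_ring_1 mat"
  assumes A: "A \<in> carrier_mat (N * m) (N * m)" and V: "V \<in> carrier_mat m m"
    and i: "i < N * m" and j: "j < N * m"
  shows "(A * block_diag N m (\<lambda>_. V)) $$ (i, j) =
    (\<Sum>l<m. A $$ (i, (j div m) * m + l) * V $$ (l, j mod m))"
proof -
  have "j div m < N" using j by (simp add: less_mult_imp_div_less)
  have "(A * block_diag N m (\<lambda>_. V)) $$ (i, j) =
      (\<Sum>k<N * m. if k div m = j div m then A $$ (i, k) * V $$ (k mod m, j mod m) else 0)"
    using A i j
    by (auto simp: scalar_prod_def block_diag_def lessThan_atLeast0 intro!: sum.cong)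
  also have "\<dots> = (\<Sum>l<m. A $$ (i, (j div m) * m + l) * V $$ (l, j mod m))"
    by (simp add: sum_div_eq[OF \<open>j div m < N\<close>])
  finally show ?thesis .
qed

lemma block_diag_mult_index:
  fixes A :: "'a :: comm_ring_1 mat"
  assumes A: "A \<in> carrier_mat (N * m) (N * m)" and U: "U \<in> carrier_mat m m"
    and i: "i < N * m" and j: "j < N * m"
  shows "(block_diag N m (\<lambda>_. U) * A) $$ (i, j) =
    (\<Sum>l<m. U $$ (i mod m, l) * A $$ ((i div m) * m + l, j))"
proof -
  have "i div m < N" using i by (simp add: less_mult_imp_div_less)
  have "(block_diag N m (\<lambda>_. U) * A) $$ (i, j) =
      (\<Sum>k<N * m. if k div m = i div m then U $$ (i mod m, k mod m) * A $$ (k, j) else 0)"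
    using A i j
    by (auto simp: scalar_prod_def block_diag_def lessThan_atLeast0 intro!: sum.cong)
  also have "\<dots> = (\<Sum>l<m. U $$ (i mod m, l) * A $$ ((i div m) * m + l, j))"
    by (simp add: sum_div_eq[OF \<open>i div m < N\<close>])
  finally show ?thesis .
qed

lemma C_block_mat_factor:
  fixes x :: "nat \<Rightarrow> nat \<Rightarrow> nat \<Rightarrow> 'a :: comm_ring_1"
  assumes zero: "\<And>r s. r \<in> {1..N} \<Longrightarrow> s \<in> {1..N} \<Longrightarrow> x r s (m + 1) = 0"
  shows "C_block_mat N m x = block_diag N m (\<lambda>_. upper_ones m) *
    diag_blocks N m (\<lambda>l. X_diff N x (Suc l)) * block_diag N m (\<lambda>_. anti_ones m)"
    (is "_ = ?U * ?D * ?V")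
proof (rule eq_matI)
  have U: "?U \<in> carrier_mat (N * m) (N * m)" by simp
  show "dim_row (C_block_mat N m x) = dim_row (?U * ?D * ?V)"
    "dim_col (C_block_mat N m x) = dim_col (?U * ?D * ?V)"
    by (simp_all add: C_block_mat_def block_diag_def)
  fix i j assume "i < dim_row (?U * ?D * ?V)" "j < dim_col (?U * ?D * ?V)"
  then have i: "i < N * m" and j: "j < N * m" by (simp_all add: block_diag_def)
  then have m: "0 < m" by (cases m) auto
  define r s a b where "r = i div m" and "s = j div m" and "a = i mod m" and "b = j mod m"
  define y where "y = x (Suc r) (Suc s)"
  \<comment> \<open>The 0-based form of the index max(p, m + 1 - q), so that \<open>Suc c\<close> is
    the subscript in the entry.\<close>
  define c where "c = max a (m - Suc b)"
  have r: "r < N" and s: "s < N" and a: "a < m" and b: "b < m"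
    using i j m by (auto simp: r_def s_def a_def b_def less_mult_imp_div_less)
  have pos: "q * m + l < N * m" if "q < N" "l < m" for q l
  proof -
    have "Suc q * m \<le> N * m" using that by (intro mult_le_mono1) simp
    then show ?thesis using that by simp
  qed
  have UD: "(?U * ?D) $$ (i, s * m + l) = (if a \<le> l then y (Suc l) - y (Suc (Suc l)) else 0)"
    if l: "l < m" for l
  proof -
    have "(?U * ?D) $$ (i, s * m + l) =
        (\<Sum>k<m. upper_ones m $$ (a, k) * ?D $$ (r * m + k, s * m + l))"
      unfolding a_def r_def using i pos[OF s l] by (intro block_diag_mult_index) auto
    \<comment> \<open>All blocks of the middle factor are diagonal, so only \<open>k = l\<close>
      survives.\<close>
    also have "\<dots> = (\<Sum>k<m. if k = l then
        upper_ones m $$ (a, l) * (y (Suc l) - y (Suc (Suc l))) else 0)"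
      using l r s by (intro sum.cong) (auto simp: diag_blocks_def pos X_diff_def y_def)
    also have "\<dots> = (if a \<le> l then y (Suc l) - y (Suc (Suc l)) else 0)"
      using l a by (simp add: upper_ones_def)
    finally show ?thesis .
  qed
  have "(?U * ?D * ?V) $$ (i, j) = (\<Sum>l<m. (?U * ?D) $$ (i, s * m + l) * anti_ones m $$ (l, b))"
    unfolding s_def b_def using i j
    by (intro mult_block_diag_index mult_carrier_mat[OF U]) auto
  \<comment> \<open>The conditions \<open>a \<le> l\<close> and \<open>m \<le> Suc (l + b)\<close>
    merge into \<open>c \<le> l\<close>; this is where the maximum arises.\<close>
  also have "\<dots> = (\<Sum>l<m. if c \<le> l then y (Suc l) - y (Suc (Suc l)) else 0)"
    using b by (intro sum.cong) (auto simp: UD anti_ones_def c_def)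
  also have "\<dots> = (\<Sum>l=c..<m. y (Suc l) - y (Suc (Suc l)))"
    by (intro sum.mono_neutral_cong_right) auto
  also have "\<dots> = - (\<Sum>l=c..<m. y (Suc (Suc l)) - y (Suc l))"
    by (simp add: sum_negf[symmetric])
  also have "\<dots> = y (Suc c) - y (Suc m)"
    using a b by (subst sum_Suc_diff'[where f = "\<lambda>l. y (Suc l)"]) (auto simp: c_def)
  \<comment> \<open>The sum has telescoped, and its upper boundary term is the vanishing element
    with subscript \<open>m + 1\<close>.\<close>
  also have "\<dots> = y (Suc c)"
    using zero[of "Suc r" "Suc s"] r s by (simp add: y_def)
  also have "Suc c = max (Suc a) (m + 1 - Suc b)"
    using b by (auto simp: c_def max_def)
  also have "y (max (Suc a) (m + 1 - Suc b)) = C_block_mat N m x $$ (i, j)"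
    using i j m by (simp add: C_block_mat_def C_mat_def y_def r_def s_def a_def b_def)
  finally show "C_block_mat N m x $$ (i, j) = (?U * ?D * ?V) $$ (i, j)" ..
qed

section \<open>Determinant and sign\<close>

text \<open>Each of the \<open>N\<close> copies of \<open>anti_ones m\<close> contributes -1 to the
  power 0 + 1 + ... + (m - 1), the copies of \<open>upper_ones m\<close> contribute 1, and the
  middle factor gives the product.\<close>

lemma det_C_block_mat:
  fixes x :: "nat \<Rightarrow> nat \<Rightarrow> nat \<Rightarrow> 'a :: comm_ring_1"
  assumes "\<And>r s. r \<in> {1..N} \<Longrightarrow> s \<in> {1..N} \<Longrightarrow> x r s (m + 1) = 0"
  shows "det (C_block_mat N m x) =
    (- 1) ^ (N * (m * (m - 1) div 2)) * (\<Prod>i = 1..m. det (X_diff N x i))"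
proof -
  let ?U = "block_diag N m (\<lambda>_. upper_ones m) :: 'a mat"
  let ?D = "diag_blocks N m (\<lambda>l. X_diff N x (Suc l))"
  let ?V = "block_diag N m (\<lambda>_. anti_ones m) :: 'a mat"
  have X: "X_diff N x l \<in> carrier_mat N N" for l by (simp add: X_diff_def)
  have sum: "(\<Sum>i<m. i) = m * (m - 1) div 2"
    by (simp add: lessThan_atLeast0 Sum_Ico_nat)
  have prod: "(\<Prod>l<m. det (X_diff N x (Suc l))) = (\<Prod>i = 1..m. det (X_diff N x i))"
    by (rule prod.reindex_bij_witness[of _ "\<lambda>i. i - 1" Suc]) auto
  have "C_block_mat N m x = ?U * ?D * ?V"
    by (rule C_block_mat_factor) (rule assms)
  then have "det (C_block_mat N m x) = det ?U * det ?D * det ?V"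
    by (simp add: det_mult[where n = "N * m"]
        mult_carrier_mat[where n = "N * m" and nr = "N * m" and nc = "N * m"])
  then show ?thesis
    by (simp add: det_block_diag det_diag_blocks X det_upper_ones det_anti_ones sum prod
        mult.commute flip: power_mult)
qed

theorem theorem2p3:
  fixes N m :: nat
    and x :: "nat \<Rightarrow> nat \<Rightarrow> nat \<Rightarrow> 'a :: comm_ring_1"
  assumes "N \<ge> 2" and "m \<ge> 1"
    and "\<And>r s. r \<in> {1..N} \<Longrightarrow> s \<in> {1..N} \<Longrightarrow> x r s (m + 1) = 0"
  shows "det (C_block_mat N m x) =
    (if even m then (- 1) ^ (N * m div 2) * (\<Prod>i = 1..m. det (X_diff N x i))
     else (- 1) ^ (N * (m - 1) div 2) * (\<Prod>i = 1..m. det (X_diff N x i)))"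
proof -
  have det: "det (C_block_mat N m x) =
      (- 1) ^ (N * (m * (m - 1) div 2)) * (\<Prod>i = 1..m. det (X_diff N x i))"
    by (rule det_C_block_mat) (rule assms(3))
  show ?thesis
  proof (cases "even m")
    case True
    then obtain k where k: "m = 2 * k" by blast
    then have e: "m * (m - 1) div 2 = k * (m - 1)" "N * m div 2 = N * k" by simp_all
    \<comment> \<open>With \<open>m \<ge> 1\<close> the natural subtraction does not truncate, so
      \<open>m - 1\<close> is odd and may be dropped from the exponent
      \<open>N * (k * (m - 1))\<close> without changing its parity.\<close>
    have "odd (m - 1)" using k assms(2) by simp
    then have "(- 1 :: 'a) ^ (N * (k * (m - 1))) = (- 1) ^ (N * k)"
      by (simp add: power_minus1_even minus_one_power_iff)
    then show ?thesis unfolding det e using True by simp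
  next
    case False
    then obtain k where k: "m = 2 * k + 1" by (rule oddE)
    then have e: "m * (m - 1) div 2 = k * m" "N * (m - 1) div 2 = N * k" by simp_all
    \<comment> \<open>Here \<open>m\<close> itself is the odd factor that does not affect the
      parity.\<close>
    have "(- 1 :: 'a) ^ (N * (k * m)) = (- 1) ^ (N * k)"
      using False by (simp add: minus_one_power_iff)
    then show ?thesis unfolding det e using False by simp
  qed
qed

end
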